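(* Let $L\ge1$ and consider an LSTM network with $L$ layers, with $n^{(l)}=n_{\mathrm{hu}}^{(l)}\ge1$ hidden units in layer $l$, inputs $\boldsymbol u_k\in\mathbb{R}^{n_u}$ and outputs $\boldsymbol y_k\in\mathbb{R}^{n_y}$, given by $$\boldsymbol c_{k+1}^{(l)}=\boldsymbol f_k^{(l)}\circ\boldsymbol c_k^{(l)}+\boldsymbol i_k^{(l)}\circ\boldsymbol g_k^{(l)},\quad \boldsymbol h_{k+1}^{(l)}=\boldsymbol o_k^{(l)}\circ\boldsymbol{\tanh}(\boldsymbol c_{k+1}^{(l)})\quad(l=1,\dots,L),\qquad \boldsymbol y_k=W_y\boldsymbol h_{k+1}^{(L)}+\boldsymbol b_y,$$ where, for each $l$, $\boldsymbol j_k^{(l)}=\boldsymbol\sigma\big(W_j^{(l)}\tilde{\boldsymbol u}_k^{(l)}+R_j^{(l)}\boldsymbol h_k^{(l)}+\boldsymbol b_j^{(l)}\big)$ for $j\in\{f,i,o\}$, $\boldsymbol g_k^{(l)}=\boldsymbol{\tanh}\big(W_g^{(l)}\tilde{\boldsymbol u}_k^{(l)}+R_g^{(l)}\boldsymbol h_k^{(l)}+\boldsymbol b_g^{(l)}\big)$, and $\tilde{\boldsymbol u}_k^{(1)}=\boldsymbol u_k$, $\tilde{\boldsymbol u}_k^{(l)}=\boldsymbol h_{k+1}^{(l-1)}$ for $l\ge2$. Here $W_j^{(1)}\in\mathbb{R}^{n^{(1)}\times n_u}$, $W_j^{(l)}\in\mathbb{R}^{n^{(l)}\times n^{(l-1)}}$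 for $l\ge2$, $R_j^{(l)}\in\mathbb{R}^{n^{(l)}\times n^{(l)}}$, $\boldsymbol b_j^{(l)}\in\mathbb{R}^{n^{(l)}}$ for $j\in\{f,i,o,g\}$, $W_y\in\mathbb{R}^{n_y\times n^{(L)}}$, $\boldsymbol b_y\in\mathbb{R}^{n_y}$. The network state is $\boldsymbol x_k=(\boldsymbol c_k^{(1)},\boldsymbol h_k^{(1)},\dots,\boldsymbol c_k^{(L)},\boldsymbol h_k^{(L)})$. Let $\boldsymbol u_{\max}\in\mathbb{R}^{n_u}$; assume that the inputs take values in $\mathcal U=\{\boldsymbol u\in\mathbb{R}^{n_u}:-\boldsymbol u_{\max}\le\boldsymbol u\le\boldsymbol u_{\max}\}$ (componentwise) and that the initial states satisfy $\boldsymbol c_0^{(l)}\in\mathbb{R}^{n^{(l)}}$, $\boldsymbol h_0^{(l)}\in(-1,1)^{n^{(l)}}$ for all $l$. Set $\tilde{\boldsymbol u}_{\max}^{(1)}=\boldsymbol u_{\max}$, $\tilde{\boldsymbol u}_{\max}^{(l)}=\boldsymbol 1_{n^{(l-1)}}$ for $l\ge2$, and, for $j\in\{f,i\}$, $$\bar\sigma_j^{(l)}=\sigma\Big(\big\|\begin{bmatrix}W_j^{(l)}\tilde{\boldsymbol u}_{\max}^{(l)} & R_j^{(l)} & \boldsymbol b_j^{(l)}\end{bmatrix}\big\|_\infty\Big).$$ If $$\bar\sigma_f^{(l)}+\bar\sigma_i^{(l)}\,\|R_g^{(l)}\|_\infty<1\qquad\text{for every } l\in\{1,\dots,L\},$$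 then the network is ISS$_\infty$, with state set $\mathcal X=\prod_{l=1}^L\big(\mathbb{R}^{n^{(l)}}\times(-1,1)^{n^{(l)}}\big)$, input set $\mathcal U$ and bias $\boldsymbol b=(\boldsymbol b_g^{(1)},\dots,\boldsymbol b_g^{(L)})$. That is, there exist $\beta\in\mathcal{KL}$ and $\gamma_u,\gamma_b\in\mathcal K_\infty$, not depending on $\boldsymbol b$, such that for every $k\in\mathbb{N}$, every $\boldsymbol x_0\in\mathcal X$, every input sequence $\boldsymbol u_0,\dots,\boldsymbol u_{k-1}\in\mathcal U$ and every $\boldsymbol b\in\prod_{l=1}^L\mathbb{R}^{n^{(l)}}$, $$\|\boldsymbol x_k\|_\infty\le\beta\big(\|\boldsymbol x_0\|_\infty,k\big)+\gamma_u\Big(\max_{0\le h<k}\|\boldsymbol u_h\|_\infty\Big)+\gamma_b\big(\|\boldsymbol b\|_\infty\big).$$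
   Context: $\mathbb{N}$ includes $0$. $\sigma(x)=1/(1+e^{-x})$; $\boldsymbol\sigma$ and $\boldsymbol{\tanh}$ denote componentwise application; $\circ$ is the componentwise (Hadamard) product; $\boldsymbol 1_n\in\mathbb{R}^n$ is the all-ones vector. $\|\cdot\|_\infty$ is the max norm for vectors and the induced $\infty$-norm (maximum absolute row sum) for matrices; $[\,W\tilde{\boldsymbol u}_{\max}\ \ R\ \ \boldsymbol b\,]$ is the horizontal concatenation, an $n^{(l)}\times(n^{(l)}+2)$ matrix for layer $l$. The maximum over the empty index set (case $k=0$) is taken to be $0$. A function $\gamma:\mathbb{R}_{\ge0}\to\mathbb{R}_{\ge0}$ is of class $\mathcal K$ if it is continuous, strictly increasing and $\gamma(0)=0$; it is of class $\mathcal K_\infty$ if moreover $\gamma(s)\to\infty$ as $s\to\infty$. A function $\beta:\mathbb{R}_{\ge0}\times\mathbb{N}\to\mathbb{R}_{\ge0}$ is of class $\mathcal{KL}$ if $\beta(\cdot,k)$ is of class $\mathcal K$ for each $k$, and for each $s$ the sequence $\beta(s,\cdot)$ is nonincreasing and tends to $0$ as $k\to\infty$. ISS$_\infty$ (general definition): a system with states $\boldsymbol x_k\in\mathcal X\subseteq\mathbb{R}^{n_x}$, inputs $\boldsymbol u_k\in\mathcal U\subseteq\mathbb{R}^{n_u}$ and bias $\boldsymbol b$ is ISS$_\infty$ if there exist $\beta\in\mathcal{KL}$, $\gamma_u,\gamma_b\in\mathcal K_\infty$ such that $\|\boldsymbol x_k\|_\infty\le\beta(\|\boldsymbol x_0\|_\infty,k)+\gamma_u(\max_{0\le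 h<k}\|\boldsymbol u_h\|_\infty)+\gamma_b(\|\boldsymbol b\|_\infty)$ for all $k\in\mathbb{N}$, all $\boldsymbol x_0\in\mathcal X$, all input sequences in $\mathcal U$ and all biases $\boldsymbol b$. *)

theory Defs
  imports Complex_Main "Jordan_Normal_Form.Matrix"
begin

subsection \<open>Comparison functions\<close>

text \<open>Functions on the nonnegative reals are represented by total functions on the type of reals,
  of which only the restriction to \<open>{0..}\<close> is constrained. Nonnegativity of the values
  there follows from monotonicity and the value at \<open>0\<close>.\<close>

definition class_K :: "(real \<Rightarrow> real) \<Rightarrow> bool" where
  "class_K \<gamma> \<longleftrightarrow> continuous_on {0..} \<gamma> \<and> strict_mono_on {0..} \<gamma> \<and> \<gamma> 0 = 0"

definition class_K_inf :: "(real \<Rightarrow> real) \<Rightarrow> bool" where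
  "class_K_inf \<gamma> \<longleftrightarrow> class_K \<gamma> \<and> filterlim \<gamma> at_top at_top"

definition class_KL :: "(real \<Rightarrow> nat \<Rightarrow> real) \<Rightarrow> bool" where
  "class_KL \<beta> \<longleftrightarrow>
     (\<forall>k. class_K (\<lambda>s. \<beta> s k)) \<and> (\<forall>s\<ge>0. antimono (\<beta> s) \<and> \<beta> s \<longlonglongrightarrow> 0)"

subsection \<open>Norms and vector operations\<close>

text \<open>In both norms, inserting \<open>0\<close> only matters for empty vectors and matrices.\<close>

definition vec_norm_inf :: "real vec \<Rightarrow> real" where
  "vec_norm_inf v = Max (insert 0 ((\<lambda>i. \<bar>v $ i\<bar>) ` {..<dim_vec v}))"

definition mat_norm_inf :: "real mat \<Rightarrow> real" where
  "mat_norm_inf A =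
     Max (insert 0 ((\<lambda>i. \<Sum>j<dim_col A. \<bar>A $$ (i, j)\<bar>) ` {..<dim_row A}))"

definition hadamard :: "real vec \<Rightarrow> real vec \<Rightarrow> real vec" (infixl \<open>\<circ>\<^sub>v\<close> 70) where
  "v \<circ>\<^sub>v w = vec (dim_vec v) (\<lambda>i. v $ i * w $ i)"

definition stack :: "real vec list \<Rightarrow> real vec" where
  "stack vs = vec_of_list (concat (map list_of_vec vs))"

definition sigmoid :: "real \<Rightarrow> real" where
  "sigmoid x = 1 / (1 + exp (- x))"

subsection \<open>Input-to-state stability in the max norm\<close>

text \<open>A system is given by its behaviour, the set of all triples consisting of a state trajectory,
  the input sequence and the (constant) bias that generate it. The inputs after time \<open>k - 1\<close> are
  unconstrained in the estimate at time \<open>k\<close>, and for \<open>k = 0\<close> the maximum over the past inputs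
  is \<open>0\<close>.\<close>

definition ISS_inf ::
  "((nat \<Rightarrow> real vec) \<times> (nat \<Rightarrow> real vec) \<times> real vec) set \<Rightarrow> real vec set \<Rightarrow> real vec set \<Rightarrow> bool"
where
  "ISS_inf S X U \<longleftrightarrow>
     (\<exists>\<beta> \<gamma>\<^sub>u \<gamma>\<^sub>b. class_KL \<beta> \<and> class_K_inf \<gamma>\<^sub>u \<and> class_K_inf \<gamma>\<^sub>b \<and>
       (\<forall>(x, u, b) \<in> S. \<forall>k. x 0 \<in> X \<longrightarrow> (\<forall>h<k. u h \<in> U) \<longrightarrow>
          vec_norm_inf (x k)
            \<le> \<beta> (vec_norm_inf (x 0)) k
              + \<gamma>\<^sub>u (Max (insert 0 ((\<lambda>h. vec_norm_inf (u h)) ` {..<k})))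
              + \<gamma>\<^sub>b (vec_norm_inf b)))"

subsection \<open>Deep LSTM networks\<close>

datatype gate = Forget | Inp | Outp | Cell

text \<open>Layers are numbered from \<open>1\<close> to \<open>depth N\<close>; the values of all layer-indexed
  components at other indices are irrelevant.\<close>

record lstm =
  depth :: nat
  n_in :: nat
  n_hu :: "nat \<Rightarrow> nat"
  n_out :: nat
  Wm :: "gate \<Rightarrow> nat \<Rightarrow> real mat"
  Rm :: "gate \<Rightarrow> nat \<Rightarrow> real mat"
  bv :: "gate \<Rightarrow> nat \<Rightarrow> real vec"
  W_y :: "real mat"
  b_y :: "real vec"

definition layer_in_dim :: "lstm \<Rightarrow> nat \<Rightarrow> nat" where
  "layer_in_dim N l = (if l = 1 then n_in N else n_hu N (l - 1))"

definition wf_lstm :: "lstm \<Rightarrow> bool" where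
  "wf_lstm N \<longleftrightarrow>
     1 \<le> depth N \<and>
     (\<forall>l \<in> {1..depth N}. 1 \<le> n_hu N l \<and>
        (\<forall>j. Wm N j l \<in> carrier_mat (n_hu N l) (layer_in_dim N l) \<and>
             Rm N j l \<in> carrier_mat (n_hu N l) (n_hu N l) \<and>
             bv N j l \<in> carrier_vec (n_hu N l))) \<and>
     W_y N \<in> carrier_mat (n_out N) (n_hu N (depth N)) \<and>
     b_y N \<in> carrier_vec (n_out N)"

definition preact :: "lstm \<Rightarrow> gate \<Rightarrow> nat \<Rightarrow> real vec \<Rightarrow> real vec \<Rightarrow> real vec" where
  "preact N j l v h = Wm N j l *\<^sub>v v + Rm N j l *\<^sub>v h + bv N j l"

text \<open>Here and in \<open>lstm_run\<close>, \<open>c l k\<close> and \<open>h l k\<close> are the cell and hidden state of layer \<open>l\<close>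
  at time \<open>k\<close>.\<close>

definition layer_input ::
  "(nat \<Rightarrow> real vec) \<Rightarrow> (nat \<Rightarrow> nat \<Rightarrow> real vec) \<Rightarrow> nat \<Rightarrow> nat \<Rightarrow> real vec" where
  "layer_input u h l k = (if l = 1 then u k else h (l - 1) (Suc k))"

definition lstm_run ::
  "lstm \<Rightarrow> (nat \<Rightarrow> real vec) \<Rightarrow> (nat \<Rightarrow> nat \<Rightarrow> real vec) \<Rightarrow> (nat \<Rightarrow> nat \<Rightarrow> real vec) \<Rightarrow>
     (nat \<Rightarrow> real vec) \<Rightarrow> bool" where
  "lstm_run N u c h y \<longleftrightarrow>
     (\<forall>k. u k \<in> carrier_vec (n_in N)) \<and>
     (\<forall>l \<in> {1..depth N}. c l 0 \<in> carrier_vec (n_hu N l) \<and> h l 0 \<in> carrier_vec (n_hu N l)) \<and>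
     (\<forall>l \<in> {1..depth N}. \<forall>k.
        (let v = layer_input u h l k;
             f = map_vec sigmoid (preact N Forget l v (h l k));
             i = map_vec sigmoid (preact N Inp l v (h l k));
             out = map_vec sigmoid (preact N Outp l v (h l k));
             g = map_vec tanh (preact N Cell l v (h l k))
         in c l (Suc k) = f \<circ>\<^sub>v c l k + i \<circ>\<^sub>v g \<and>
            h l (Suc k) = out \<circ>\<^sub>v map_vec tanh (c l (Suc k)))) \<and>
     (\<forall>k. y k = W_y N *\<^sub>v h (depth N) (Suc k) + b_y N)"

definition stack_state :: "lstm \<Rightarrow> (nat \<Rightarrow> real vec) \<Rightarrow> (nat \<Rightarrow> real vec) \<Rightarrow> real vec" where
  "stack_state N c h = stack (concat (map (\<lambda>l. [c l, h l]) [1..<Suc (depth N)]))"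

definition stack_bias :: "lstm \<Rightarrow> (nat \<Rightarrow> real vec) \<Rightarrow> real vec" where
  "stack_bias N bg = stack (map bg [1..<Suc (depth N)])"

text \<open>The cell bias is a quantity of the behaviour: it ranges over all values and
  replaces the one stored in \<open>N\<close>, while all other parameters are those of \<open>N\<close>.\<close>

definition with_cell_bias :: "lstm \<Rightarrow> (nat \<Rightarrow> real vec) \<Rightarrow> lstm" where
  "with_cell_bias N bg = N\<lparr>bv := (bv N)(Cell := bg)\<rparr>"

definition lstm_system ::
  "lstm \<Rightarrow> ((nat \<Rightarrow> real vec) \<times> (nat \<Rightarrow> real vec) \<times> real vec) set" where
  "lstm_system N =
     {(\<lambda>k. stack_state N (\<lambda>l. c l k) (\<lambda>l. h l k), u, stack_bias N bg) | c h u y bg.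
        (\<forall>l \<in> {1..depth N}. bg l \<in> carrier_vec (n_hu N l)) \<and>
        lstm_run (with_cell_bias N bg) u c h y}"

definition lstm_state_set :: "lstm \<Rightarrow> real vec set" where
  "lstm_state_set N =
     {stack_state N c h | c h. \<forall>l \<in> {1..depth N}.
        c l \<in> carrier_vec (n_hu N l) \<and> h l \<in> carrier_vec (n_hu N l) \<and>
        (\<forall>i < n_hu N l. h l $ i \<in> {-1<..<1})}"

definition input_box :: "lstm \<Rightarrow> real vec \<Rightarrow> real vec set" where
  "input_box N u_max = {u \<in> carrier_vec (n_in N). - u_max \<le> u \<and> u \<le> u_max}"

definition layer_input_max :: "lstm \<Rightarrow> real vec \<Rightarrow> nat \<Rightarrow> real vec" where
  "layer_input_max N u_max l = (if l = 1 then u_max else vec (n_hu N (l - 1)) (\<lambda>_. 1))"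

text \<open>The matrix with columns \<open>Wm N j l *\<^sub>v layer_input_max N u_max l\<close>, the columns
  of \<open>Rm N j l\<close>, and \<open>bv N j l\<close> is the horizontal concatenation. Note that the
  entrywise absolute value is taken only after the product with the input bound.\<close>

definition sigma_bar :: "lstm \<Rightarrow> real vec \<Rightarrow> gate \<Rightarrow> nat \<Rightarrow> real" where
  "sigma_bar N u_max j l =
     sigmoid (mat_norm_inf (mat_of_cols (n_hu N l)
       ([Wm N j l *\<^sub>v layer_input_max N u_max l] @ cols (Rm N j l) @ [bv N j l])))"

subsection \<open>Every initial state, input sequence and cell bias has a trajectory\<close>

fun lstm_sol ::
  "lstm \<Rightarrow> (nat \<Rightarrow> real vec) \<Rightarrow> (nat \<Rightarrow> real vec) \<Rightarrow> (nat \<Rightarrow> real vec) \<Rightarrow> nat \<Rightarrow> nat \<Rightarrow> real vec \<times> real vec"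
where
  "lstm_sol N u c0 h0 0 l = (c0 l, h0 l)"
| "lstm_sol N u c0 h0 (Suc k) 0 = (c0 0, h0 0)"
| "lstm_sol N u c0 h0 (Suc k) (Suc l) =
     (let v = (if l = 0 then u k else snd (lstm_sol N u c0 h0 (Suc k) l));
          s = lstm_sol N u c0 h0 k (Suc l);
          c = map_vec sigmoid (preact N Forget (Suc l) v (snd s)) \<circ>\<^sub>v fst s
              + map_vec sigmoid (preact N Inp (Suc l) v (snd s))
                \<circ>\<^sub>v map_vec tanh (preact N Cell (Suc l) v (snd s))
      in (c, map_vec sigmoid (preact N Outp (Suc l) v (snd s)) \<circ>\<^sub>v map_vec tanh c))"

lemma lstm_run_exists:
  assumes "\<And>k. u k \<in> carrier_vec (n_in N)"
    and "\<And>l. l \<in> {1..depth N} \<Longrightarrow>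
           c0 l \<in> carrier_vec (n_hu N l) \<and> h0 l \<in> carrier_vec (n_hu N l)"
  shows "\<exists>c h y. lstm_run N u c h y \<and> (\<forall>l. c l 0 = c0 l \<and> h l 0 = h0 l)"
proof -
  define c where "c = (\<lambda>l k. fst (lstm_sol N u c0 h0 k l))"
  define h where "h = (\<lambda>l k. snd (lstm_sol N u c0 h0 k l))"
  define y where "y = (\<lambda>k. W_y N *\<^sub>v h (depth N) (Suc k) + b_y N)"
  have "lstm_run N u c h y"
    unfolding lstm_run_def
  proof (intro conjI ballI allI, goal_cases)
    case (4 l k)
    then obtain m where "l = Suc m" by (cases l) auto
    then show ?case
      by (simp add: c_def h_def Let_def layer_input_def)
  qed (use assms in \<open>auto simp: c_def h_def y_def\<close>)
  moreover have "\<forall>l. c l 0 = c0 l \<and> h l 0 = h0 l"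
    by (simp add: c_def h_def)
  ultimately show ?thesis by blast
qed

end

theory Submission
  imports Defs
begin

text \<open>
  Let \<open>m\<close> be the maximum of the norms of the cell and hidden state of a layer, and \<open>v\<close> the norm of
  its input. Since \<open>sigma_bar\<close> dominates the recurrent and bias parts of the gates, the hypothesis
  and continuity make the layer contract for \<open>v \<le> \<delta>\<close>. For \<open>v > \<delta>\<close> the gates are still bounded
  away from \<open>1\<close> because inputs and hidden states are bounded, and the cell input is at most
  \<open>1 < v / \<delta>\<close>. Hence \<open>m' \<le> r m + w v + b\<close> with \<open>r < 1\<close> in all cases. In particular, the product
  with the input bound inside \<open>sigma_bar\<close>, which does not bound \<open>W u\<close> when the entries of \<open>W\<close> have
  mixed signs, plays no role. The cascade of these linear inequalities is
  handled by a sum over the layers with geometrically decaying weights, so that \<open>\<beta>\<close> can be taken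
  exponential in time and \<open>\<gamma>\<^sub>u\<close>, \<open>\<gamma>\<^sub>b\<close> linear.
\<close>

subsection \<open>Norms\<close>

text \<open>Norm estimates are reduced to entrywise bounds through this equivalence. The conjunct
  \<open>0 \<le> c\<close> comes from the inserted \<open>0\<close> and covers empty
  vectors.\<close>

lemma vec_norm_inf_le_iff:
  "vec_norm_inf v \<le> c \<longleftrightarrow> 0 \<le> c \<and> (\<forall>i<dim_vec v. \<bar>v $ i\<bar> \<le> c)"
  unfolding vec_norm_inf_def by (subst Max_le_iff) auto

lemma vec_norm_inf_nonneg: "0 \<le> vec_norm_inf v"
  unfolding vec_norm_inf_def by (rule Max_ge) auto

lemma abs_vec_index_le: "i < dim_vec v \<Longrightarrow> \<bar>v $ i\<bar> \<le> vec_norm_inf v"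
  using vec_norm_inf_le_iff[of v "vec_norm_inf v"] by simp

lemma mat_norm_inf_nonneg: "0 \<le> mat_norm_inf A"
  unfolding mat_norm_inf_def by (rule Max_ge) auto

lemma row_sum_le_mat_norm_inf:
  "i < dim_row A \<Longrightarrow> (\<Sum>j<dim_col A. \<bar>A $$ (i, j)\<bar>) \<le> mat_norm_inf A"
  unfolding mat_norm_inf_def by (rule Max_ge) auto

lemma abs_mult_mat_vec_index_le:
  assumes "i < dim_row A" "dim_vec v = dim_col A"
  shows "\<bar>(A *\<^sub>v v) $ i\<bar> \<le> (\<Sum>j<dim_col A. \<bar>A $$ (i, j)\<bar>) * vec_norm_inf v"
proof -
  have "\<bar>(A *\<^sub>v v) $ i\<bar> = \<bar>\<Sum>j<dim_col A. A $$ (i, j) * v $ j\<bar>"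
    using assms by (simp add: scalar_prod_def atLeast0LessThan)
  also have "\<dots> \<le> (\<Sum>j<dim_col A. \<bar>A $$ (i, j)\<bar> * \<bar>v $ j\<bar>)"
    by (rule order_trans[OF sum_abs]) (simp add: abs_mult)
  also have "\<dots> \<le> (\<Sum>j<dim_col A. \<bar>A $$ (i, j)\<bar> * vec_norm_inf v)"
    using assms by (intro sum_mono mult_left_mono abs_vec_index_le) auto
  finally show ?thesis by (simp add: sum_distrib_right)
qed

lemma abs_mult_mat_vec_index_le_norm:
  assumes "i < dim_row A" "dim_vec v = dim_col A"
  shows "\<bar>(A *\<^sub>v v) $ i\<bar> \<le> mat_norm_inf A * vec_norm_inf v"
  using abs_mult_mat_vec_index_le[OF assms]
    mult_right_mono[OF row_sum_le_mat_norm_inf[OF assms(1)] vec_norm_inf_nonneg[of v]]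
  by linarith

lemma vec_norm_inf_le_iff_list:
  "vec_norm_inf v \<le> c \<longleftrightarrow> 0 \<le> c \<and> (\<forall>x \<in> set (list_of_vec v). \<bar>x\<bar> \<le> c)"
  unfolding vec_norm_inf_le_iff set_list_of_vec by (auto intro: vec_setI elim!: vec_setE)

lemma vec_norm_inf_stack_le_iff:
  "vec_norm_inf (stack vs) \<le> c \<longleftrightarrow> 0 \<le> c \<and> (\<forall>v \<in> set vs. vec_norm_inf v \<le> c)"
  unfolding vec_norm_inf_le_iff_list stack_def by (auto simp: list_vec)

lemma vec_norm_inf_stack_state_le_iff:
  "vec_norm_inf (stack_state N c h) \<le> C \<longleftrightarrow>
     0 \<le> C \<and> (\<forall>l \<in> {1..depth N}. vec_norm_inf (c l) \<le> C \<and> vec_norm_inf (h l) \<le> C)"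
  unfolding stack_state_def vec_norm_inf_stack_le_iff
  by (auto simp del: upt_Suc)

lemma vec_norm_inf_le_stack_bias:
  "l \<in> {1..depth N} \<Longrightarrow> vec_norm_inf (b l) \<le> vec_norm_inf (stack_bias N b)"
  using vec_norm_inf_stack_le_iff[of "map b [1..<Suc (depth N)]" "vec_norm_inf (stack_bias N b)"]
  unfolding stack_bias_def by (auto simp del: upt_Suc)

lemma vec_norm_inf_input_box:
  assumes "u \<in> input_box N u_max"
  shows "vec_norm_inf u \<le> vec_norm_inf u_max"
proof -
  have "\<bar>u $ i\<bar> \<le> vec_norm_inf u_max" if "i < dim_vec u" for i
  proof -
    have le: "- u_max \<le> u" "u \<le> u_max"
      using assms by (simp_all add: input_box_def)
    \<comment> \<open>The order on vectors entails equal dimensions.\<close>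
    then have "dim_vec u_max = dim_vec u"
      by (simp add: less_eq_vec_def)
    moreover from le this that have "- (u_max $ i) \<le> u $ i" "u $ i \<le> u_max $ i"
      unfolding less_eq_vec_def by (metis index_uminus_vec)+
    ultimately
    show ?thesis using abs_vec_index_le[of i u_max] that by auto
  qed
  then show ?thesis by (simp add: vec_norm_inf_le_iff vec_norm_inf_nonneg)
qed

subsection \<open>Activation functions\<close>

lemma sigmoid_pos: "0 < sigmoid x"
  by (simp add: sigmoid_def add_pos_pos)

lemma sigmoid_less_1: "sigmoid x < 1"
  by (simp add: sigmoid_def divide_simps add_pos_pos)

lemma sigmoid_mono: "x \<le> y \<Longrightarrow> sigmoid x \<le> sigmoid y"
  unfolding sigmoid_def by (intro divide_left_mono mult_pos_pos add_pos_pos) auto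

lemma isCont_sigmoid: "isCont sigmoid x"
  unfolding sigmoid_def
  by (intro continuous_intros) (use exp_gt_zero[of "- x"] in linarith)

lemma abs_tanh_le_1: "\<bar>tanh (x :: real)\<bar> \<le> 1"
  using tanh_real_bounds[of x] by (simp add: abs_le_iff)

lemma abs_tanh_le_abs: "\<bar>tanh (x :: real)\<bar> \<le> \<bar>x\<bar>"
proof -
  have *: "tanh x \<le> x" if "0 \<le> x" for x :: real
  proof -
    \<comment> \<open>The derivative of \<open>x - tanh x\<close> is the square of
      \<open>tanh\<close>. Negative arguments follow below by oddness.\<close>
    have "\<exists>D. ((\<lambda>x. x - tanh x) has_real_derivative D) (at y) \<and> 0 \<le> D" for y :: real
      by (rule exI[of _ "1 - (1 - tanh y ^ 2)"])
        (auto intro!: derivative_eq_intros)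
    then have "0 - tanh 0 \<le> x - tanh x"
      by (intro DERIV_nonneg_imp_nondecreasing[OF that]) auto
    then show ?thesis by simp
  qed
  show ?thesis
    using *[of "\<bar>x\<bar>"] by (cases "0 \<le> x") (auto simp: abs_if)
qed

subsection \<open>Gain of a single layer\<close>

text \<open>The variables \<open>v\<close>, \<open>a\<close>, \<open>e\<close>, \<open>b\<close>
  stand for the norms of layer input, cell state, hidden state and cell bias. The
  \<open>min 1\<close> combines the two bounds on \<open>tanh\<close>, by its argument and by 1:
  small \<open>v\<close> uses the former, large \<open>v\<close> the latter.\<close>

lemma layer_gain_exists:
  fixes Sf Si \<omega> \<omega>g \<rho>g M :: real
  assumes "sigmoid Sf + sigmoid Si * \<rho>g < 1" "0 \<le> \<omega>" "0 \<le> \<omega>g" "0 \<le> \<rho>g" "0 \<le> M"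
  shows "\<exists>r w. 0 < r \<and> r < 1 \<and> 0 \<le> w \<and>
    (\<forall>v a e b. 0 \<le> v \<and> v \<le> M \<and> 0 \<le> a \<and> 0 \<le> e \<and> e \<le> 1 \<and> 0 \<le> b \<longrightarrow>
       sigmoid (\<omega> * v + Sf) * a + sigmoid (\<omega> * v + Si) * min 1 (\<omega>g * v + \<rho>g * e + b)
         \<le> r * max a e + w * v + b)"
proof -
  \<comment> \<open>\<open>F v\<close> is the contraction factor at input norm \<open>v\<close>; the
    first hypothesis says \<open>F 0 < 1\<close>.\<close>
  define F where "F v = sigmoid (\<omega> * v + Sf) + sigmoid (\<omega> * v + Si) * \<rho>g" for v
  have "isCont F 0"
    unfolding F_def
    by (intro continuous_intros isCont_o2[OF _ isCont_sigmoid])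
  moreover obtain \<rho> where \<rho>: "F 0 < \<rho>" "\<rho> < 1"
    using assms(1) dense[of "F 0" 1] by (auto simp: F_def)
  ultimately have "\<forall>\<^sub>F v in at 0. F v < \<rho>"
    by (auto simp: isCont_def dest: order_tendstoD)
  then obtain d where d: "0 < d" "\<And>v. v \<noteq> 0 \<Longrightarrow> \<bar>v\<bar> < d \<Longrightarrow> F v < \<rho>"
    by (auto simp: eventually_at dist_real_def)
  \<comment> \<open>Each maximum has one entry per case: \<open>\<rho>\<close> and
    \<open>\<omega>g\<close> serve \<open>v < d\<close>, while the largest possible forget gate and
    \<open>1 / d\<close> serve \<open>v \<ge> d\<close>.\<close>
  define r where "r = max \<rho> (sigmoid (\<omega> * M + Sf))"
  define w where "w = max \<omega>g (1 / d)"
  have r: "0 < r" "r < 1"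
    using \<rho> sigmoid_pos[of "\<omega> * M + Sf"] sigmoid_less_1 by (auto simp: r_def)
  have w: "0 \<le> w" using assms by (simp add: w_def)
  have "sigmoid (\<omega> * v + Sf) * a + sigmoid (\<omega> * v + Si) * min 1 (\<omega>g * v + \<rho>g * e + b)
          \<le> r * max a e + w * v + b"
    if v: "0 \<le> v" "v \<le> M" and a: "0 \<le> a" and e: "0 \<le> e" "e \<le> 1" and b: "0 \<le> b" for v a e b
  proof -
    define f where "f = sigmoid (\<omega> * v + Sf)"
    define i where "i = sigmoid (\<omega> * v + Si)"
    define g where "g = min 1 (\<omega>g * v + \<rho>g * e + b)"
    have i: "0 < i" "i < 1" and f: "0 < f"
      by (auto simp: i_def f_def sigmoid_pos sigmoid_less_1)
    have wv: "\<omega>g * v \<le> w * v" using v by (intro mult_right_mono) (auto simp: w_def)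
    have "f * a + i * g \<le> r * max a e + w * v + b"
    proof (cases "v < d")
      \<comment> \<open>The cell input is bounded by the linear argument of \<open>min\<close>. The
        gate factor \<open>i < 1\<close> is kept on the recurrent term, where it enters
        \<open>F\<close>, and dropped on input and bias.\<close>
      case True
      then have "F v \<le> \<rho>" using d(2)[of v] \<rho> v by (cases "v = 0") auto
      then have fi: "f + i * \<rho>g \<le> r" by (simp add: F_def f_def i_def r_def)
      have "i * g \<le> i * (\<rho>g * e) + i * (\<omega>g * v + b)"
        using i by (simp add: g_def flip: distrib_left)
      moreover have "i * (\<omega>g * v + b) \<le> \<omega>g * v + b"
        using i v b assms by (intro mult_left_le_one_le add_nonneg_nonneg mult_nonneg_nonneg) auto
      moreover have "i * (\<rho>g * e) \<le> i * (\<rho>g * max a e)"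
        using i assms by (intro mult_left_mono) auto
      moreover have "f * a \<le> f * max a e" using f by (intro mult_left_mono) auto
      moreover have "(f + i * \<rho>g) * max a e \<le> r * max a e"
        using fi a by (intro mult_right_mono) auto
      ultimately show ?thesis using wv by (simp add: algebra_simps)
    next
      \<comment> \<open>The forget gate alone contracts, and the whole cell input is charged to
        \<open>w * v\<close>.\<close>
      case False
      have "f \<le> r" unfolding f_def r_def
        using v assms by (intro max.coboundedI2 sigmoid_mono add_right_mono mult_left_mono) auto
      then have "f * a \<le> r * max a e" using f a r by (intro mult_mono) auto
      moreover have "i * g \<le> 1 * 1"
        using i v e b assms by (intro mult_mono) (auto simp: g_def)
      moreover have "1 \<le> (1 / d) * v" using False d by (simp add: field_simps)
      moreover have "(1 / d) * v \<le> w * v"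
        using v by (intro mult_right_mono) (auto simp: w_def)
      ultimately show ?thesis using b by simp
    qed
    then show ?thesis by (simp only: f_def i_def g_def)
  qed
  then show ?thesis using r w by blast
qed

subsection \<open>Cascades of linear recursions\<close>

text \<open>\<open>D / (1 - q)\<close> is the fixed point of the affine step. The recursion is
  assumed only before time \<open>k\<close>, since later inputs are unconstrained.\<close>

lemma linear_recursion_bound:
  fixes z :: "nat \<Rightarrow> real"
  assumes "0 \<le> q" "q < 1" "0 \<le> D" "\<And>j. j < k \<Longrightarrow> z (Suc j) \<le> q * z j + D"
  shows "z k \<le> q ^ k * z 0 + D / (1 - q)"
  using assms(4)
proof (induction k)
  case 0
  then show ?case using assms by simp
next
  case (Suc k)
  have "z (Suc k) \<le> q * z k + D" using Suc.prems by simp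
  also have "\<dots> \<le> q * (q ^ k * z 0 + D / (1 - q)) + D"
    using Suc assms by (intro add_right_mono mult_left_mono) auto
  also have "\<dots> = q ^ Suc k * z 0 + D / (1 - q)"
    using assms by (simp add: field_simps)
  finally show ?case .
qed

text \<open>Level \<open>0\<close> carries the external input, and level \<open>l + 1\<close> is driven by the already updated
  level \<open>l\<close>.\<close>

lemma cascade_bound_exists:
  fixes r w :: real
  assumes r: "0 < r" "r < 1" and w: "0 \<le> w"
  obtains q K where "0 < q" "q < 1" "0 < K"
    "\<And>m V B s k l. (\<And>l j. 0 \<le> m l j) \<Longrightarrow> 0 \<le> V \<Longrightarrow> 0 \<le> B \<Longrightarrow>
       (\<And>l. l < L \<Longrightarrow> m (Suc l) 0 \<le> s) \<Longrightarrow> (\<And>j. j < k \<Longrightarrow> m 0 (Suc j) \<le> V) \<Longrightarrow>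
       (\<And>l j. l < L \<Longrightarrow> j < k \<Longrightarrow>
          m (Suc l) (Suc j) \<le> r * m (Suc l) j + w * m l (Suc j) + B) \<Longrightarrow>
       l < L \<Longrightarrow> m (Suc l) k \<le> K * (q ^ k * s + V + B)"
proof -
  \<comment> \<open>The weight \<open>t\<close> ensures \<open>t * w \<le> (1 - r) / 2\<close>,
    hence \<open>1 - t * w \<ge> (1 + r) / 2\<close>, and dividing \<open>r\<close> by the latter
    yields \<open>q\<close>. In \<open>D\<close> the factor 2 bounds \<open>2 / (1 + r)\<close>. In
    \<open>K\<close> the division by \<open>t ^ L\<close> undoes the smallest weight, and the
    summand 1 makes \<open>K\<close> positive.\<close>
  define t where "t = (1 - r) / (2 * (1 + w))"
  define q where "q = 2 * r / (1 + r)"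
  define D where "D = 2 * (w + real L) / (1 - q)"
  define K where "K = (real L + D + 1) / t ^ L"
  have t: "0 < t" "t \<le> 1" using r w by (auto simp: t_def field_simps)
  have q: "0 < q" "q < 1" using r by (auto simp: q_def field_simps)
  have D: "0 \<le> D" using q w by (simp add: D_def)
  have K: "0 < K" using t D by (simp add: K_def)
  have "t * w \<le> t * (1 + w)" using t by simp
  also have "\<dots> = (1 - r) / 2" using w by (simp add: t_def divide_simps)
  finally have tw: "t * w \<le> (1 - r) / 2" .
  have main: "m (Suc l) k \<le> K * (q ^ k * s + V + B)"
    if nn: "\<And>l j. 0 \<le> m l j" and V: "0 \<le> V" and B: "0 \<le> B"
      and s: "\<And>l. l < L \<Longrightarrow> m (Suc l) 0 \<le> s"
      and mV: "\<And>j. j < k \<Longrightarrow> m 0 (Suc j) \<le> V"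
      and step: "\<And>l j. l < L \<Longrightarrow> j < k \<Longrightarrow>
        m (Suc l) (Suc j) \<le> r * m (Suc l) j + w * m l (Suc j) + B"
      and l: "l < L" for m :: "nat \<Rightarrow> nat \<Rightarrow> real" and V B s k l
  proof -
    \<comment> \<open>As each level is driven by the updated level below, the weighted sum at the
      new time occurs on both sides of its recursion, with the factor \<open>t * w\<close> on the
      right; this term is absorbed on the left.\<close>
    define Z where "Z j = (\<Sum>l<L. t ^ l * m (Suc l) j)" for j
    have Z_nn: "0 \<le> Z j" for j unfolding Z_def using t nn by (intro sum_nonneg) auto
    have Z_step: "Z (Suc j) \<le> q * Z j + 2 * (w * V + real L * B)" if j: "j < k" for j
    proof -
      \<comment> \<open>Adding the top level completes the index shift: level 0 splits off and the
        rest is \<open>t * Z (Suc j)\<close>.\<close>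
      have "(\<Sum>l<L. t ^ l * m l (Suc j)) \<le> (\<Sum>l<Suc L. t ^ l * m l (Suc j))"
        using t nn by (intro sum_mono2) auto
      also have "\<dots> = m 0 (Suc j) + t * Z (Suc j)"
        by (simp add: sum.lessThan_Suc_shift Z_def sum_distrib_left mult.assoc del: sum.lessThan_Suc)
      finally have shift: "(\<Sum>l<L. t ^ l * m l (Suc j)) \<le> V + t * Z (Suc j)"
        using mV[OF j] by linarith
      have B_sum: "(\<Sum>l<L. t ^ l * B) \<le> real L * B"
        using sum_bounded_above[of "{..<L}" "\<lambda>l. t ^ l * B" B] t B
        by (simp add: mult_left_le_one_le power_le_one)
      have "Z (Suc j) \<le> (\<Sum>l<L. t ^ l * (r * m (Suc l) j + w * m l (Suc j) + B))"
        unfolding Z_def using t j by (intro sum_mono mult_left_mono step) auto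
      also have "\<dots> = r * Z j + w * (\<Sum>l<L. t ^ l * m l (Suc j)) + (\<Sum>l<L. t ^ l * B)"
        by (simp add: Z_def sum_distrib_left sum.distrib algebra_simps)
      also have "\<dots> \<le> r * Z j + w * (V + t * Z (Suc j)) + real L * B"
        using mult_left_mono[OF shift w] B_sum by linarith
      finally have "(1 - t * w) * Z (Suc j) \<le> r * Z j + (w * V + real L * B)"
        by (simp add: algebra_simps)
      moreover have "(1 + r) / 2 * Z (Suc j) \<le> (1 - t * w) * Z (Suc j)"
        using tw Z_nn by (intro mult_right_mono) (auto simp: field_simps)
      ultimately have "(1 + r) / 2 * Z (Suc j) \<le> r * Z j + (w * V + real L * B)" by linarith
      then have "2 / (1 + r) * ((1 + r) / 2 * Z (Suc j))
          \<le> 2 / (1 + r) * (r * Z j + (w * V + real L * B))"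
        using r by (intro mult_left_mono) auto
      then have "Z (Suc j) \<le> q * Z j + 2 / (1 + r) * (w * V + real L * B)"
        using r by (simp add: q_def distrib_left)
      also have "2 / (1 + r) * (w * V + real L * B) \<le> 2 * (w * V + real L * B)"
        using r w V B by (intro mult_right_mono) (auto simp: field_simps)
      finally show ?thesis by simp
    qed
    have s0: "0 \<le> s" using nn[of "Suc l" 0] s[OF l] by linarith
    have "Z 0 \<le> (\<Sum>l<L. 1 * s)"
      unfolding Z_def using t nn s by (intro sum_mono mult_mono) (auto intro: power_le_one)
    then have Z0: "Z 0 \<le> real L * s" by simp
    have "w * V + real L * B \<le> (w + real L) * (V + B)"
      using w V B by (simp add: algebra_simps)
    then have "2 * (w * V + real L * B) / (1 - q) \<le> 2 * ((w + real L) * (V + B)) / (1 - q)"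
      using q by (intro divide_right_mono) auto
    then have D_le: "2 * (w * V + real L * B) / (1 - q) \<le> D * (V + B)"
      by (simp only: D_def times_divide_eq_left mult.assoc)
    \<comment> \<open>A single level is recovered from the weighted sum, because all its summands
      are nonnegative and \<open>t \<le> 1\<close>.\<close>
    have "t ^ L * m (Suc l) k \<le> t ^ l * m (Suc l) k"
      using t nn l by (intro mult_right_mono power_decreasing) auto
    also have "\<dots> \<le> Z k"
      unfolding Z_def using t nn l by (intro member_le_sum) auto
    also have "\<dots> \<le> q ^ k * Z 0 + 2 * (w * V + real L * B) / (1 - q)"
      using Z_step q w V B by (intro linear_recursion_bound) auto
    also have "\<dots> \<le> q ^ k * (real L * s) + D * (V + B)"
      using Z0 q D_le by (intro add_mono mult_left_mono) auto
    also have "\<dots> \<le> (real L + D + 1) * (q ^ k * s) + (real L + D + 1) * (V + B)"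
      using q D s0 V B by (intro add_mono) (auto simp: algebra_simps)
    finally show ?thesis using t by (simp add: K_def field_simps)
  qed
  show thesis
  proof (rule that[OF q K], goal_cases)
    case (1 m V B s k l)
    then show ?case by (intro main[of m V B s k l]) auto
  qed
qed

subsection \<open>The network\<close>

lemma mat_norm_inf_concat_ge:
  assumes R: "R \<in> carrier_mat n n" and "a \<in> carrier_vec n" and b: "b \<in> carrier_vec n" and i: "i < n"
  shows "(\<Sum>j<n. \<bar>R $$ (i, j)\<bar>) + \<bar>b $ i\<bar> \<le> mat_norm_inf (mat_of_cols n ([a] @ cols R @ [b]))"
proof -
  let ?A = "mat_of_cols n ([a] @ cols R @ [b])"
  have dims: "dim_row ?A = n" "dim_col ?A = Suc (Suc n)" using R by auto
  have entry_R: "?A $$ (i, Suc j) = R $$ (i, j)" if "j < n" for j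
    using R i that by (simp add: mat_of_cols_def nth_append)
  have entry_b: "?A $$ (i, Suc n) = b $ i"
    using R i by (simp add: mat_of_cols_def nth_append)
  have "(\<Sum>j<n. \<bar>R $$ (i, j)\<bar>) + \<bar>b $ i\<bar> = (\<Sum>j<Suc n. \<bar>?A $$ (i, Suc j)\<bar>)"
    using entry_R entry_b by simp
  \<comment> \<open>Column 0 holds \<open>a\<close>; the recurrent columns and the bias occupy the
    indices from 1 to \<open>Suc n\<close>.\<close>
  also have "\<dots> \<le> (\<Sum>j<Suc (Suc n). \<bar>?A $$ (i, j)\<bar>)"
    unfolding sum.lessThan_Suc_shift[of _ "Suc n"] by simp
  also have "\<dots> \<le> mat_norm_inf ?A"
    using row_sum_le_mat_norm_inf[of i ?A] i unfolding dims by simp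
  finally show ?thesis .
qed

lemma preact_dims:
  assumes "wf_lstm N" "l \<in> {1..depth N}"
  shows "Wm N j l \<in> carrier_mat (n_hu N l) (layer_in_dim N l)"
    "Rm N j l \<in> carrier_mat (n_hu N l) (n_hu N l)" "bv N j l \<in> carrier_vec (n_hu N l)"
  using assms unfolding wf_lstm_def by simp_all

lemma dim_preact:
  assumes "wf_lstm N" "l \<in> {1..depth N}"
  shows "dim_vec (preact N j l v h) = n_hu N l"
  using preact_dims(3)[OF assms, of j] by (simp add: preact_def)

text \<open>The recurrent part and the bias are kept row by row: the norm of the concatenation is a
  maximum over rows of their sum, which the sum of separate norms of \<open>R\<close> and
  \<open>b\<close> could exceed.\<close>

lemma abs_preact_le:
  assumes "W \<in> carrier_mat n p" "R \<in> carrier_mat n n" "b \<in> carrier_vec n"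
    "v \<in> carrier_vec p" "h \<in> carrier_vec n" "i < n"
  shows "\<bar>(W *\<^sub>v v + R *\<^sub>v h + b) $ i\<bar>
    \<le> mat_norm_inf W * vec_norm_inf v + (\<Sum>j<n. \<bar>R $$ (i, j)\<bar>) * vec_norm_inf h + \<bar>b $ i\<bar>"
proof -
  have "(W *\<^sub>v v + R *\<^sub>v h + b) $ i = (W *\<^sub>v v) $ i + (R *\<^sub>v h) $ i + b $ i"
    using assms by (simp del: index_mult_mat_vec)
  then show ?thesis
    using abs_mult_mat_vec_index_le_norm[of i W v] abs_mult_mat_vec_index_le[of i R h] assms
    by (auto simp del: index_mult_mat_vec)
qed

text \<open>At input norm 0 the bound is exactly \<open>sigma_bar N u_max j l\<close>; the actual
  input enters through \<open>\<omega>\<close> instead.\<close>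

lemma sigmoid_gate_le:
  assumes "wf_lstm N" "l \<in> {1..depth N}" "u_max \<in> carrier_vec (n_in N)"
    and v: "v \<in> carrier_vec (layer_in_dim N l)" and h: "h \<in> carrier_vec (n_hu N l)"
    and h1: "vec_norm_inf h \<le> 1" and W: "mat_norm_inf (Wm N j l) \<le> \<omega>" and i: "i < n_hu N l"
  shows "sigmoid (preact N j l v h $ i) \<le> sigmoid (\<omega> * vec_norm_inf v +
    mat_norm_inf (mat_of_cols (n_hu N l)
       ([Wm N j l *\<^sub>v layer_input_max N u_max l] @ cols (Rm N j l) @ [bv N j l])))"
proof (rule sigmoid_mono)
  note dims = preact_dims[OF assms(1,2), of j]
  let ?S = "\<Sum>i'<n_hu N l. \<bar>Rm N j l $$ (i, i')\<bar>"
  have "preact N j l v h $ i \<le> mat_norm_inf (Wm N j l) * vec_norm_inf v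
      + ?S * vec_norm_inf h + \<bar>bv N j l $ i\<bar>"
    using abs_preact_le[OF dims v h i] unfolding preact_def by linarith
  moreover have "mat_norm_inf (Wm N j l) * vec_norm_inf v \<le> \<omega> * vec_norm_inf v"
    using W by (intro mult_right_mono vec_norm_inf_nonneg)
  moreover have "?S * vec_norm_inf h \<le> ?S * 1"
    using h1 by (intro mult_left_mono) (auto intro: sum_nonneg)
  moreover have "?S + \<bar>bv N j l $ i\<bar> \<le> mat_norm_inf (mat_of_cols (n_hu N l)
       ([Wm N j l *\<^sub>v layer_input_max N u_max l] @ cols (Rm N j l) @ [bv N j l]))"
    using dims i by (intro mat_norm_inf_concat_ge carrier_vecI) (simp_all add: carrier_matD(1))
  ultimately show "preact N j l v h $ i \<le> \<omega> * vec_norm_inf v +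
    mat_norm_inf (mat_of_cols (n_hu N l)
       ([Wm N j l *\<^sub>v layer_input_max N u_max l] @ cols (Rm N j l) @ [bv N j l]))"
    by linarith
qed

lemma abs_lstm_cell_le:
  fixes f i g c F I G a :: real
  assumes "0 \<le> f" "f \<le> F" "0 \<le> i" "i \<le> I" "\<bar>g\<bar> \<le> G" "\<bar>c\<bar> \<le> a"
  shows "\<bar>f * c + i * g\<bar> \<le> F * a + I * G"
proof -
  have "\<bar>f * c + i * g\<bar> \<le> \<bar>f\<bar> * \<bar>c\<bar> + \<bar>i\<bar> * \<bar>g\<bar>"
    by (metis abs_mult abs_triangle_ineq)
  also have "\<dots> \<le> F * a + I * G" using assms by (intro add_mono mult_mono) auto
  finally show ?thesis .
qed

section \<open>One-step estimates for a layer\<close>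

definition lstm_cell :: "lstm \<Rightarrow> nat \<Rightarrow> real vec \<Rightarrow> real vec \<Rightarrow> real vec \<Rightarrow> real vec" where
  "lstm_cell N l v c h =
     map_vec sigmoid (preact N Forget l v h) \<circ>\<^sub>v c
     + map_vec sigmoid (preact N Inp l v h) \<circ>\<^sub>v map_vec tanh (preact N Cell l v h)"

definition lstm_hidden :: "lstm \<Rightarrow> nat \<Rightarrow> real vec \<Rightarrow> real vec \<Rightarrow> real vec \<Rightarrow> real vec" where
  "lstm_hidden N l v c h =
     map_vec sigmoid (preact N Outp l v h) \<circ>\<^sub>v map_vec tanh (lstm_cell N l v c h)"

lemma lstm_runD:
  assumes "lstm_run N u c h y" "l \<in> {1..depth N}"
  shows "c l (Suc k) = lstm_cell N l (layer_input u h l k) (c l k) (h l k)"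
    and "h l (Suc k) = lstm_hidden N l (layer_input u h l k) (c l k) (h l k)"
proof -
  have "c l (Suc k) = lstm_cell N l (layer_input u h l k) (c l k) (h l k) \<and>
    h l (Suc k) = map_vec sigmoid (preact N Outp l (layer_input u h l k) (h l k))
      \<circ>\<^sub>v map_vec tanh (c l (Suc k))"
    using assms unfolding lstm_run_def Let_def lstm_cell_def by blast
  then show "c l (Suc k) = lstm_cell N l (layer_input u h l k) (c l k) (h l k)"
    "h l (Suc k) = lstm_hidden N l (layer_input u h l k) (c l k) (h l k)"
    unfolding lstm_hidden_def by auto
qed

text \<open>A preactivation has the dimension of its bias and \<open>hadamard\<close> that of its
  first factor, so the dimensions are right whatever \<open>v\<close>, \<open>c\<close> and
  \<open>h\<close> are.\<close>

lemma lstm_step_dims: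
  assumes "wf_lstm N" "l \<in> {1..depth N}"
  shows "lstm_cell N l v c h \<in> carrier_vec (n_hu N l)"
    and "lstm_hidden N l v c h \<in> carrier_vec (n_hu N l)"
  by (intro carrier_vecI;
      simp add: lstm_cell_def lstm_hidden_def hadamard_def dim_preact[OF assms])+

lemma lstm_cell_index:
  assumes "wf_lstm N" "l \<in> {1..depth N}" "i < n_hu N l"
  shows "lstm_cell N l v c h $ i =
    sigmoid (preact N Forget l v h $ i) * c $ i
    + sigmoid (preact N Inp l v h $ i) * tanh (preact N Cell l v h $ i)"
  using assms by (simp add: lstm_cell_def hadamard_def dim_preact)

lemma lstm_hidden_index_le:
  assumes "wf_lstm N" "l \<in> {1..depth N}" "i < n_hu N l"
  shows "\<bar>lstm_hidden N l v c h $ i\<bar> \<le> \<bar>tanh (lstm_cell N l v c h $ i)\<bar>"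
proof -
  have "lstm_hidden N l v c h $ i
      = sigmoid (preact N Outp l v h $ i) * tanh (lstm_cell N l v c h $ i)"
    using assms lstm_step_dims(1)[OF assms(1,2), of v c h]
    by (simp add: lstm_hidden_def hadamard_def dim_preact)
  then show ?thesis
    using sigmoid_pos[of "preact N Outp l v h $ i"] sigmoid_less_1[of "preact N Outp l v h $ i"]
    by (simp add: abs_mult mult_left_le_one_le)
qed

text \<open>The first bound keeps hidden states within norm 1 after the first step. The second makes
  a bound on the new cell state suffice for the whole new layer state.\<close>

lemma vec_norm_inf_lstm_hidden:
  assumes "wf_lstm N" "l \<in> {1..depth N}"
  shows "vec_norm_inf (lstm_hidden N l v c h) \<le> 1"
    and "vec_norm_inf (lstm_hidden N l v c h) \<le> vec_norm_inf (lstm_cell N l v c h)"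
proof -
  have "\<bar>lstm_hidden N l v c h $ i\<bar> \<le> 1 \<and>
      \<bar>lstm_hidden N l v c h $ i\<bar> \<le> vec_norm_inf (lstm_cell N l v c h)" if "i < n_hu N l" for i
    using lstm_hidden_index_le[OF assms that, of v c h] abs_tanh_le_1[of "lstm_cell N l v c h $ i"]
      abs_tanh_le_abs[of "lstm_cell N l v c h $ i"]
      abs_vec_index_le[of i "lstm_cell N l v c h"] lstm_step_dims(1)[OF assms, of v c h] that
    by auto
  then show "vec_norm_inf (lstm_hidden N l v c h) \<le> 1"
    "vec_norm_inf (lstm_hidden N l v c h) \<le> vec_norm_inf (lstm_cell N l v c h)"
    using lstm_step_dims(2)[OF assms, of v c h] by (auto simp: vec_norm_inf_le_iff vec_norm_inf_nonneg)
qed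

text \<open>Gates and \<open>tanh\<close> are bounded by 1 at every hidden state, so this estimate
  covers a first step from a hidden state of norm above 1.\<close>

lemma vec_norm_inf_lstm_cell_le_add_1:
  assumes "wf_lstm N" "l \<in> {1..depth N}" "c \<in> carrier_vec (n_hu N l)"
  shows "vec_norm_inf (lstm_cell N l v c h) \<le> vec_norm_inf c + 1"
proof -
  have "\<bar>lstm_cell N l v c h $ i\<bar> \<le> 1 * vec_norm_inf c + 1 * 1" if "i < n_hu N l" for i
    unfolding lstm_cell_index[OF assms(1,2) that] using assms that
    by (intro abs_lstm_cell_le)
      (auto intro: less_imp_le sigmoid_pos sigmoid_less_1 abs_tanh_le_1 abs_vec_index_le)
  then show ?thesis
    using lstm_step_dims(1)[OF assms(1,2), of v c h]
    by (auto simp: vec_norm_inf_le_iff vec_norm_inf_nonneg add_nonneg_nonneg)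
qed

text \<open>The right-hand side has the shape treated in \<open>layer_gain_exists\<close>, with
  \<open>\<omega>\<close> in the place of both input gains.\<close>

lemma vec_norm_inf_lstm_cell_le:
  assumes "wf_lstm N" "l \<in> {1..depth N}" "u_max \<in> carrier_vec (n_in N)"
    and v: "v \<in> carrier_vec (layer_in_dim N l)" and c: "c \<in> carrier_vec (n_hu N l)"
    and h: "h \<in> carrier_vec (n_hu N l)" and h1: "vec_norm_inf h \<le> 1"
    and W: "\<And>j. mat_norm_inf (Wm N j l) \<le> \<omega>"
  defines "S j \<equiv> mat_norm_inf (mat_of_cols (n_hu N l)
       ([Wm N j l *\<^sub>v layer_input_max N u_max l] @ cols (Rm N j l) @ [bv N j l]))"
  shows "vec_norm_inf (lstm_cell N l v c h)
    \<le> sigmoid (\<omega> * vec_norm_inf v + S Forget) * vec_norm_inf c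
      + sigmoid (\<omega> * vec_norm_inf v + S Inp)
        * min 1 (\<omega> * vec_norm_inf v + mat_norm_inf (Rm N Cell l) * vec_norm_inf h
                 + vec_norm_inf (bv N Cell l))" (is "_ \<le> ?F * _ + ?I * ?G")
proof -
  have \<omega>: "0 \<le> \<omega>" using W[of Cell] mat_norm_inf_nonneg[of "Wm N Cell l"] by linarith
  note dims = preact_dims[OF assms(1,2), of Cell]
  have "\<bar>lstm_cell N l v c h $ i\<bar> \<le> ?F * vec_norm_inf c + ?I * ?G" if i: "i < n_hu N l" for i
  proof -
    let ?p = "preact N Cell l v h $ i"
    have "\<bar>?p\<bar> \<le> mat_norm_inf (Wm N Cell l) * vec_norm_inf v
        + (\<Sum>j<n_hu N l. \<bar>Rm N Cell l $$ (i, j)\<bar>) * vec_norm_inf h + \<bar>bv N Cell l $ i\<bar>"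
      using abs_preact_le[OF dims v h i] by (simp add: preact_def)
    also have "\<dots> \<le> \<omega> * vec_norm_inf v + mat_norm_inf (Rm N Cell l) * vec_norm_inf h
        + vec_norm_inf (bv N Cell l)"
      using dims i W row_sum_le_mat_norm_inf[of i "Rm N Cell l"]
      by (intro add_mono mult_right_mono vec_norm_inf_nonneg abs_vec_index_le) auto
    finally have "\<bar>tanh ?p\<bar> \<le> ?G"
      using abs_tanh_le_1[of ?p] abs_tanh_le_abs[of ?p] by linarith
    then show ?thesis
      unfolding lstm_cell_index[OF assms(1,2) i] S_def using i c
      by (intro abs_lstm_cell_le sigmoid_gate_le[OF assms(1-3) v h h1 W])
        (auto intro: less_imp_le sigmoid_pos abs_vec_index_le)
  qed
  moreover have "0 \<le> ?F * vec_norm_inf c + ?I * ?G"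
    using \<omega> by (intro add_nonneg_nonneg mult_nonneg_nonneg)
      (auto intro: less_imp_le sigmoid_pos simp: vec_norm_inf_nonneg mat_norm_inf_nonneg)
  ultimately show ?thesis
    using lstm_step_dims(1)[OF assms(1,2), of v c h] by (auto simp: vec_norm_inf_le_iff)
qed

section \<open>Gain constants common to all layers and cell biases\<close>

lemma common_gain_exists:
  fixes P :: "nat \<Rightarrow> real \<Rightarrow> real \<Rightarrow> bool"
  assumes "\<And>l. l \<le> n \<Longrightarrow> \<exists>r w. 0 < r \<and> r < 1 \<and> 0 \<le> w \<and> P l r w"
    and mono: "\<And>l r w r' w'. P l r w \<Longrightarrow> r \<le> r' \<Longrightarrow> w \<le> w' \<Longrightarrow> P l r' w'"
  shows "\<exists>r w. 0 < r \<and> r < 1 \<and> 0 \<le> w \<and> (\<forall>l\<le>n. P l r w)"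
  using assms(1)
proof (induction n)
  case 0
  then show ?case by simp
next
  case (Suc n)
  obtain r w where 1: "0 < r" "r < 1" "0 \<le> w" "\<forall>l\<le>n. P l r w"
    using Suc.IH Suc.prems by (metis le_SucI)
  obtain r' w' where 2: "0 < r'" "r' < 1" "0 \<le> w'" "P (Suc n) r' w'"
    using Suc.prems[of "Suc n"] by auto
  \<comment> \<open>Monotonicity of \<open>P\<close> allows passing to maxima, and a maximum of two
    numbers below 1 stays below 1.\<close>
  have "P l (max r r') (max w w')" if "l \<le> Suc n" for l
    using mono[of l r w] mono[of l r' w'] 1(4) 2(4) that by (cases "l = Suc n") auto
  then show ?case
    using 1 2 by (intro exI[of _ "max r r'"] exI[of _ "max w w'"]) auto
qed

lemma with_cell_bias_simps [simp]:
  "depth (with_cell_bias N bg) = depth N"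
  "n_in (with_cell_bias N bg) = n_in N"
  "n_hu (with_cell_bias N bg) = n_hu N"
  "n_out (with_cell_bias N bg) = n_out N"
  "W_y (with_cell_bias N bg) = W_y N"
  "b_y (with_cell_bias N bg) = b_y N"
  "Wm (with_cell_bias N bg) = Wm N"
  "Rm (with_cell_bias N bg) = Rm N"
  "bv (with_cell_bias N bg) = (bv N)(Cell := bg)"
  "layer_in_dim (with_cell_bias N bg) = layer_in_dim N"
  "layer_input_max (with_cell_bias N bg) = layer_input_max N"
  by (auto simp: with_cell_bias_def layer_in_dim_def layer_input_max_def fun_eq_iff)

text \<open>The constants are quantified before \<open>bg\<close>, because the gain functions of the
  network must not depend on the cell bias.\<close>

lemma lstm_layer_gain_exists:
  assumes "wf_lstm N" "u_max \<in> carrier_vec (n_in N)"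
    and l: "l \<in> {1..depth N}"
    and gain: "sigma_bar N u_max Forget l + sigma_bar N u_max Inp l * mat_norm_inf (Rm N Cell l) < 1"
    and M: "0 \<le> M"
  shows "\<exists>r w. 0 < r \<and> r < 1 \<and> 0 \<le> w \<and>
    (\<forall>bg v c h. wf_lstm (with_cell_bias N bg) \<longrightarrow> v \<in> carrier_vec (layer_in_dim N l) \<longrightarrow>
       c \<in> carrier_vec (n_hu N l) \<longrightarrow> h \<in> carrier_vec (n_hu N l) \<longrightarrow>
       vec_norm_inf h \<le> 1 \<longrightarrow> vec_norm_inf v \<le> M \<longrightarrow>
       vec_norm_inf (lstm_cell (with_cell_bias N bg) l v c h)
         \<le> r * max (vec_norm_inf c) (vec_norm_inf h) + w * vec_norm_inf v + vec_norm_inf (bg l))"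
proof -
  define \<omega> where "\<omega> = Max (range (\<lambda>j. mat_norm_inf (Wm N j l)))"
  have "finite (UNIV :: gate set)"
    by (rule finite_subset[of _ "{Forget, Inp, Outp, Cell}"]) (auto intro: gate.exhaust)
  then have W: "mat_norm_inf (Wm N j l) \<le> \<omega>" for j
    unfolding \<omega>_def by (intro Max_ge) auto
  then have \<omega>: "0 \<le> \<omega>" using mat_norm_inf_nonneg[of "Wm N Cell l"] by (meson order_trans)
  define S where "S j = mat_norm_inf (mat_of_cols (n_hu N l)
       ([Wm N j l *\<^sub>v layer_input_max N u_max l] @ cols (Rm N j l) @ [bv N j l]))" for j
  let ?R = "mat_norm_inf (Rm N Cell l)"
  obtain r w where rw: "0 < r" "r < 1" "0 \<le> w"
    and bound: "\<And>v a e b. 0 \<le> v \<Longrightarrow> v \<le> M \<Longrightarrow> 0 \<le> a \<Longrightarrow> 0 \<le> e \<Longrightarrow> e \<le> 1 \<Longrightarrow> 0 \<le> b \<Longrightarrow>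
       sigmoid (\<omega> * v + S Forget) * a + sigmoid (\<omega> * v + S Inp) * min 1 (\<omega> * v + ?R * e + b)
         \<le> r * max a e + w * v + b"
    using layer_gain_exists[of "S Forget" "S Inp" ?R \<omega> \<omega> M] gain \<omega> M mat_norm_inf_nonneg
    unfolding sigma_bar_def S_def by metis
  have "vec_norm_inf (lstm_cell (with_cell_bias N bg) l v c h)
         \<le> r * max (vec_norm_inf c) (vec_norm_inf h) + w * vec_norm_inf v + vec_norm_inf (bg l)"
    if wf: "wf_lstm (with_cell_bias N bg)" and "v \<in> carrier_vec (layer_in_dim N l)"
      "c \<in> carrier_vec (n_hu N l)" "h \<in> carrier_vec (n_hu N l)"
      "vec_norm_inf h \<le> 1" "vec_norm_inf v \<le> M" for bg v c h
  proof -
    have "vec_norm_inf (lstm_cell (with_cell_bias N bg) l v c h)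
      \<le> sigmoid (\<omega> * vec_norm_inf v + S Forget) * vec_norm_inf c
        + sigmoid (\<omega> * vec_norm_inf v + S Inp)
          * min 1 (\<omega> * vec_norm_inf v + ?R * vec_norm_inf h + vec_norm_inf (bg l))"
      \<comment> \<open>Replacing the cell bias leaves \<open>S Forget\<close> and
        \<open>S Inp\<close> unchanged, as they involve only the biases of their own gates.\<close>
      using vec_norm_inf_lstm_cell_le[OF wf, of l u_max v c h \<omega>] l assms(2) that W
      by (simp add: S_def)
    also have "\<dots> \<le> r * max (vec_norm_inf c) (vec_norm_inf h) + w * vec_norm_inf v
        + vec_norm_inf (bg l)"
      using that by (intro bound vec_norm_inf_nonneg)
    finally show ?thesis .
  qed
  then show ?thesis using rw by blast
qed

lemma lstm_gain_exists:
  assumes "wf_lstm N" "u_max \<in> carrier_vec (n_in N)"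
    and "\<forall>l \<in> {1..depth N}.
           sigma_bar N u_max Forget l + sigma_bar N u_max Inp l * mat_norm_inf (Rm N Cell l) < 1"
    and "0 \<le> M"
  obtains r w where "0 < r" "r < 1" "0 \<le> w"
    "\<And>l bg v c h. l \<in> {1..depth N} \<Longrightarrow> wf_lstm (with_cell_bias N bg) \<Longrightarrow>
       v \<in> carrier_vec (layer_in_dim N l) \<Longrightarrow> c \<in> carrier_vec (n_hu N l) \<Longrightarrow>
       h \<in> carrier_vec (n_hu N l) \<Longrightarrow> vec_norm_inf h \<le> 1 \<Longrightarrow> vec_norm_inf v \<le> M \<Longrightarrow>
       vec_norm_inf (lstm_cell (with_cell_bias N bg) l v c h)
         \<le> r * max (vec_norm_inf c) (vec_norm_inf h) + w * vec_norm_inf v + vec_norm_inf (bg l)"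
proof -
  \<comment> \<open>The guard makes \<open>P\<close> vacuous at layer 0, which
    \<open>common_gain_exists\<close> includes in its range.\<close>
  define P where "P l r w \<longleftrightarrow> (l \<in> {1..depth N} \<longrightarrow>
    (\<forall>bg v c h. wf_lstm (with_cell_bias N bg) \<longrightarrow> v \<in> carrier_vec (layer_in_dim N l) \<longrightarrow>
       c \<in> carrier_vec (n_hu N l) \<longrightarrow> h \<in> carrier_vec (n_hu N l) \<longrightarrow>
       vec_norm_inf h \<le> 1 \<longrightarrow> vec_norm_inf v \<le> M \<longrightarrow>
       vec_norm_inf (lstm_cell (with_cell_bias N bg) l v c h)
         \<le> r * max (vec_norm_inf c) (vec_norm_inf h) + w * vec_norm_inf v + vec_norm_inf (bg l)))"
    for l r w
  have ex: "\<exists>r w. 0 < r \<and> r < 1 \<and> 0 \<le> w \<and> P l r w" for l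
  proof (cases "l \<in> {1..depth N}")
    case True
    then show ?thesis
      using lstm_layer_gain_exists[OF assms(1,2) True _ assms(4)] assms(3) unfolding P_def by simp
  next
    case False
    then show ?thesis
      unfolding P_def by (intro exI[of _ "1 / 2"] exI[of _ 0]) auto
  qed
  have mono: "P l r' w'" if "P l r w" "r \<le> r'" "w \<le> w'" for l r w r' w'
  proof -
    have "r * max (vec_norm_inf c) (vec_norm_inf h) + w * vec_norm_inf v + vec_norm_inf b
      \<le> r' * max (vec_norm_inf c) (vec_norm_inf h) + w' * vec_norm_inf v + vec_norm_inf b"
      for c h v b
      using that by (intro add_mono mult_right_mono) (auto simp: vec_norm_inf_nonneg le_max_iff_disj)
    then show ?thesis using that(1) unfolding P_def by (meson order_trans)
  qed
  obtain r w where "0 < r" "r < 1" "0 \<le> w" "\<forall>l\<le>depth N. P l r w"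
    using common_gain_exists[of "depth N" P] ex mono by metis
  then show ?thesis using that[of r w] unfolding P_def by simp
qed

section \<open>Trajectories of the whole network\<close>

lemma wf_with_cell_bias:
  assumes "wf_lstm N" "\<forall>l \<in> {1..depth N}. bg l \<in> carrier_vec (n_hu N l)"
  shows "wf_lstm (with_cell_bias N bg)"
  using assms by (auto simp: wf_lstm_def)

lemma lstm_run_dims:
  assumes "wf_lstm N" "lstm_run N u c h y" "l \<in> {1..depth N}"
  shows "c l k \<in> carrier_vec (n_hu N l)" "h l k \<in> carrier_vec (n_hu N l)"
    "layer_input u h l k \<in> carrier_vec (layer_in_dim N l)"
proof -
  have *: "c l k \<in> carrier_vec (n_hu N l) \<and> h l k \<in> carrier_vec (n_hu N l)"
    if "l \<in> {1..depth N}" for l k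
  proof (cases k)
    case 0
    then show ?thesis using assms(2) that unfolding lstm_run_def by blast
  next
    case (Suc j)
    then show ?thesis
      using lstm_step_dims[OF assms(1) that] lstm_runD[OF assms(2) that, of j] by simp
  qed
  show "c l k \<in> carrier_vec (n_hu N l)" "h l k \<in> carrier_vec (n_hu N l)"
    using *[OF assms(3)] by auto
  show "layer_input u h l k \<in> carrier_vec (layer_in_dim N l)"
  proof (cases "l = 1")
    case True
    then show ?thesis
      using assms(2) by (simp add: layer_input_def layer_in_dim_def lstm_run_def)
  next
    case False
    then have "l - 1 \<in> {1..depth N}" using assms(3) by auto
    then show ?thesis using *[of "l - 1"] False by (simp add: layer_input_def layer_in_dim_def)
  qed
qed

lemma lstm_run_bound_exists:
  assumes "wf_lstm N" "u_max \<in> carrier_vec (n_in N)"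
    and "\<forall>l \<in> {1..depth N}.
           sigma_bar N u_max Forget l + sigma_bar N u_max Inp l * mat_norm_inf (Rm N Cell l) < 1"
  obtains q K where "0 < q" "q < 1" "0 < K"
    "\<And>c h u y bg k V. \<forall>l \<in> {1..depth N}. bg l \<in> carrier_vec (n_hu N l) \<Longrightarrow>
       lstm_run (with_cell_bias N bg) u c h y \<Longrightarrow> \<forall>j<k. u j \<in> input_box N u_max \<Longrightarrow>
       0 \<le> V \<Longrightarrow> \<forall>j<k. vec_norm_inf (u j) \<le> V \<Longrightarrow>
       vec_norm_inf (stack_state N (\<lambda>l. c l k) (\<lambda>l. h l k))
         \<le> K * (q ^ k * vec_norm_inf (stack_state N (\<lambda>l. c l 0) (\<lambda>l. h l 0)) + V
                + vec_norm_inf (stack_bias N bg))"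
proof -
  \<comment> \<open>\<open>M\<close> bounds the inputs of all layers: the external ones by
    \<open>u_max\<close>, those of deeper layers by 1, as they are updated hidden states.\<close>
  define M where "M = max 1 (vec_norm_inf u_max)"
  have M: "0 \<le> M" by (simp add: M_def)
  obtain r w where rw: "0 < r" "r < 1" "0 \<le> w"
    and gain: "\<And>l bg v c h. l \<in> {1..depth N} \<Longrightarrow> wf_lstm (with_cell_bias N bg) \<Longrightarrow>
       v \<in> carrier_vec (layer_in_dim N l) \<Longrightarrow> c \<in> carrier_vec (n_hu N l) \<Longrightarrow>
       h \<in> carrier_vec (n_hu N l) \<Longrightarrow> vec_norm_inf h \<le> 1 \<Longrightarrow> vec_norm_inf v \<le> M \<Longrightarrow>
       vec_norm_inf (lstm_cell (with_cell_bias N bg) l v c h)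
         \<le> r * max (vec_norm_inf c) (vec_norm_inf h) + w * vec_norm_inf v + vec_norm_inf (bg l)"
    using lstm_gain_exists[OF assms M] by blast
  obtain q K where qK: "0 < q" "q < 1" "0 < K"
    and cascade: "\<And>m V B s k l. (\<And>l j. 0 \<le> m l j) \<Longrightarrow> 0 \<le> V \<Longrightarrow> 0 \<le> B \<Longrightarrow>
       (\<And>l. l < depth N \<Longrightarrow> m (Suc l) 0 \<le> s) \<Longrightarrow> (\<And>j. j < k \<Longrightarrow> m 0 (Suc j) \<le> V) \<Longrightarrow>
       (\<And>l j. l < depth N \<Longrightarrow> j < k \<Longrightarrow>
          m (Suc l) (Suc j) \<le> r * m (Suc l) j + w * m l (Suc j) + B) \<Longrightarrow>
       l < depth N \<Longrightarrow> m (Suc l) k \<le> K * (q ^ k * s + V + B)"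
    by (fact cascade_bound_exists[OF rw])
  define K' where "K' = K * (2 / r)"
  have K': "0 < K'" using qK rw by (simp add: K'_def)
  have "vec_norm_inf (stack_state N (\<lambda>l. c l k) (\<lambda>l. h l k)) \<le> K' * (q ^ k * s + V + B)"
    if bg: "\<forall>l \<in> {1..depth N}. bg l \<in> carrier_vec (n_hu N l)"
      and run: "lstm_run (with_cell_bias N bg) u c h y"
      and box: "\<forall>j<k. u j \<in> input_box N u_max"
      and V: "0 \<le> V" "\<forall>j<k. vec_norm_inf (u j) \<le> V"
      and s_def: "s = vec_norm_inf (stack_state N (\<lambda>l. c l 0) (\<lambda>l. h l 0))"
      and B_def: "B = vec_norm_inf (stack_bias N bg)" for c h u y bg k V s B
  proof -
    let ?N = "with_cell_bias N bg"
    have wf: "wf_lstm ?N" by (rule wf_with_cell_bias[OF assms(1) bg])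
    have s: "0 \<le> s" and B: "0 \<le> B" by (simp_all add: s_def B_def vec_norm_inf_nonneg)
    define z where "z l j = max (vec_norm_inf (c l j)) (vec_norm_inf (h l j))" for l j
    \<comment> \<open>The initial value is inflated by \<open>2 / r\<close> because the hidden state may exceed \<open>1\<close> at time \<open>0\<close>, so that
      only \<open>z l 1 \<le> 2 * z l 0\<close> is available there.\<close>
    define m where "m l j = (if l = 0 then vec_norm_inf (u (j - 1))
        else (if j = 0 then 2 / r else 1) * z l j)" for l j
    have z_nn: "0 \<le> z l j" for l j by (simp add: z_def vec_norm_inf_nonneg le_max_iff_disj)
    have m_nn: "0 \<le> m l j" for l j using z_nn rw by (simp add: m_def vec_norm_inf_nonneg)
    have z_le_m: "z (Suc l) j \<le> m (Suc l) j" for l j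
      using mult_right_mono[OF _ z_nn, of 1 "2 / r" "Suc l" j] rw by (auto simp: m_def)
    have m0: "m (Suc l) 0 \<le> (2 / r) * s" if "l < depth N" for l
    proof -
      have "z (Suc l) 0 \<le> s"
        using that vec_norm_inf_stack_state_le_iff[of N "\<lambda>l. c l 0" "\<lambda>l. h l 0" s]
        by (auto simp: z_def s_def)
      then show ?thesis using rw by (simp add: m_def divide_right_mono)
    qed
    have h_le: "vec_norm_inf (h l (Suc j)) \<le> 1"
      "vec_norm_inf (h l (Suc j)) \<le> vec_norm_inf (c l (Suc j))" if "l \<in> {1..depth N}" for l j
      using vec_norm_inf_lstm_hidden[OF wf, of l] lstm_runD[OF run, of l] that by auto
    have step: "m (Suc l) (Suc j) \<le> r * m (Suc l) j + w * m l (Suc j) + B"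
      if l: "l < depth N" and j: "j < k" for l j
    proof -
      let ?v = "layer_input u h (Suc l) j"
      have l': "Suc l \<in> {1..depth N}" using l by simp
      note dims = lstm_run_dims[OF wf run, of "Suc l", simplified, OF Suc_leI[OF l]]
      note cell = lstm_runD(1)[OF run, of "Suc l" j]
      \<comment> \<open>The time shift in \<open>m\<close> at level 0 makes
        \<open>m 0 (Suc j)\<close> the norm of \<open>u j\<close>, in line with deeper layers, whose
        input is the hidden state below at time \<open>Suc j\<close>.\<close>
      have "vec_norm_inf ?v \<le> m l (Suc j)"
      proof (cases l)
        case (Suc l0)
        then show ?thesis by (simp add: layer_input_def m_def z_def)
      qed (simp add: layer_input_def m_def)
      then have wv: "w * vec_norm_inf ?v \<le> w * m l (Suc j)"
        using rw by (intro mult_left_mono)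
      have vM: "vec_norm_inf ?v \<le> M"
      proof (cases l)
        case 0
        then show ?thesis
          using vec_norm_inf_input_box[of "u j" N u_max] box j by (simp add: layer_input_def M_def)
      next
        case (Suc l0)
        then show ?thesis
          using h_le(1)[of l j] l by (simp add: layer_input_def M_def)
      qed
      have b: "vec_norm_inf (bg (Suc l)) \<le> B"
        unfolding B_def by (rule vec_norm_inf_le_stack_bias[OF l'])
      have "vec_norm_inf (c (Suc l) (Suc j)) \<le> r * m (Suc l) j + w * m l (Suc j) + B"
      proof (cases "vec_norm_inf (h (Suc l) j) \<le> 1")
        case True
        have "vec_norm_inf (c (Suc l) (Suc j))
            \<le> r * z (Suc l) j + w * vec_norm_inf ?v + vec_norm_inf (bg (Suc l))"
          unfolding z_def using gain[OF l' wf _ _ _ True vM] dims cell l by simp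
        moreover have "r * z (Suc l) j \<le> r * m (Suc l) j"
          using rw z_le_m by (intro mult_left_mono) auto
        ultimately show ?thesis using wv b by linarith
      next
        case False
        \<comment> \<open>Hidden states have norm at most 1 from time 1 on. At time 0 the excess
          over 1 puts the added 1 below \<open>z\<close>, and the factor \<open>2 / r\<close> in
          \<open>m\<close> cancels \<open>r\<close>.\<close>
        then have j0: "j = 0" using h_le(1)[OF l'] by (cases j) auto
        have "vec_norm_inf (c (Suc l) (Suc j)) \<le> vec_norm_inf (c (Suc l) j) + 1"
          using vec_norm_inf_lstm_cell_le_add_1[OF wf, of "Suc l"] dims cell l by simp
        also have "\<dots> \<le> 2 * z (Suc l) j" using False by (simp add: z_def)
        also have "\<dots> = r * m (Suc l) j" using j0 rw by (simp add: m_def)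
        also have "\<dots> \<le> r * m (Suc l) j + w * m l (Suc j) + B"
          using rw m_nn[of l "Suc j"] B by simp
        finally show ?thesis .
      qed
      \<comment> \<open>By \<open>h_le(2)\<close> the maximum in \<open>z\<close> at time
        \<open>Suc j\<close> is the norm of the cell state.\<close>
      then show ?thesis using h_le(2)[OF l'] by (simp add: m_def z_def)
    qed
    have "m (Suc l) k \<le> K' * (q ^ k * s + V + B)" if "l < depth N" for l
    proof -
      have "m (Suc l) k \<le> K * (q ^ k * ((2 / r) * s) + V + B)"
        using m_nn V B m0 step that by (intro cascade[where m = m and V = V and B = B]) (auto simp: m_def)
      \<comment> \<open>As \<open>2 / r \<ge> 1\<close>, the inflation of the initial value may be
        applied to \<open>V\<close> and \<open>B\<close> too, giving the common factor
        \<open>K'\<close>.\<close>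
      also have "\<dots> \<le> K * (q ^ k * ((2 / r) * s) + (2 / r) * V + (2 / r) * B)"
        using qK rw V B mult_right_mono[of 1 "2 / r" V] mult_right_mono[of 1 "2 / r" B]
        by (intro mult_left_mono add_mono) auto
      also have "\<dots> = K' * (q ^ k * s + V + B)" by (simp add: K'_def algebra_simps add_divide_distrib)
      finally show ?thesis .
    qed
    then have "z (Suc l) k \<le> K' * (q ^ k * s + V + B)" if "l < depth N" for l
      using z_le_m[of l k] that by (meson order_trans)
    then have "z l k \<le> K' * (q ^ k * s + V + B)" if "l \<in> {1..depth N}" for l
      using that by (cases l) auto
    moreover have "0 \<le> K' * (q ^ k * s + V + B)" using K' qK s V B by simp
    ultimately show ?thesis
      unfolding vec_norm_inf_stack_state_le_iff by (simp add: z_def)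
  qed
  then show ?thesis using that[of q K'] qK K' by blast
qed

section \<open>Comparison functions and the stability estimate\<close>

lemma class_K_inf_linear: "0 < K \<Longrightarrow> class_K_inf (\<lambda>s. K * s)"
  unfolding class_K_inf_def class_K_def
  by (auto intro!: continuous_intros strict_mono_onI filterlim_tendsto_pos_mult_at_top
      filterlim_ident)

text \<open>Positivity of \<open>q\<close> gives strict growth in \<open>s\<close> at every time
  \<open>k\<close>, and \<open>q < 1\<close> gives the decay in \<open>k\<close>.\<close>

lemma class_KL_exponential:
  assumes "0 < K" "0 < q" "q < 1"
  shows "class_KL (\<lambda>s k. K * (q ^ k * s))"
  unfolding class_KL_def
proof (intro conjI allI impI)
  fix k
  show "class_K (\<lambda>s. K * (q ^ k * s))"
    using class_K_inf_linear[of "K * q ^ k"] assms by (simp add: class_K_inf_def mult.assoc)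
next
  fix s :: real
  assume "0 \<le> s"
  then show "antimono (\<lambda>k. K * (q ^ k * s))"
    using assms by (intro antimonoI mult_left_mono mult_right_mono power_decreasing) auto
  have "(\<lambda>k. K * (q ^ k * s)) \<longlonglongrightarrow> K * (0 * s)"
    using assms by (intro tendsto_intros LIMSEQ_power_zero) auto
  then show "(\<lambda>k. K * (q ^ k * s)) \<longlonglongrightarrow> 0" by simp
qed

theorem theorem2:
  fixes N :: lstm and u_max :: "real vec"
  assumes "wf_lstm N"
    and "u_max \<in> carrier_vec (n_in N)"
    and "\<forall>l \<in> {1..depth N}.
           sigma_bar N u_max Forget l + sigma_bar N u_max Inp l * mat_norm_inf (Rm N Cell l) < 1"
  shows "ISS_inf (lstm_system N) (lstm_state_set N) (input_box N u_max)"
proof -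
  obtain q K where qK: "0 < q" "q < 1" "0 < K"
    and bound: "\<And>c h u y bg k V. \<forall>l \<in> {1..depth N}. bg l \<in> carrier_vec (n_hu N l) \<Longrightarrow>
       lstm_run (with_cell_bias N bg) u c h y \<Longrightarrow> \<forall>j<k. u j \<in> input_box N u_max \<Longrightarrow>
       0 \<le> V \<Longrightarrow> \<forall>j<k. vec_norm_inf (u j) \<le> V \<Longrightarrow>
       vec_norm_inf (stack_state N (\<lambda>l. c l k) (\<lambda>l. h l k))
         \<le> K * (q ^ k * vec_norm_inf (stack_state N (\<lambda>l. c l 0) (\<lambda>l. h l 0)) + V
                + vec_norm_inf (stack_bias N bg))"
    using lstm_run_bound_exists[OF assms] by blast
  have "vec_norm_inf (x k) \<le> K * (q ^ k * vec_norm_inf (x 0))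
      + K * Max (insert 0 ((\<lambda>h. vec_norm_inf (u h)) ` {..<k})) + K * vec_norm_inf b"
    if S: "(x, u, b) \<in> lstm_system N" and box: "\<forall>h<k. u h \<in> input_box N u_max" for x u b k
  proof -
    from S obtain c h y bg where x: "x = (\<lambda>k. stack_state N (\<lambda>l. c l k) (\<lambda>l. h l k))"
      and b: "b = stack_bias N bg" and bg: "\<forall>l \<in> {1..depth N}. bg l \<in> carrier_vec (n_hu N l)"
      and run: "lstm_run (with_cell_bias N bg) u c h y"
      unfolding lstm_system_def by blast
    \<comment> \<open>The inserted \<open>0\<close> makes \<open>V\<close> nonnegative and equal to
      0 at \<open>k = 0\<close>, so that \<open>V\<close> is an admissible input bound at every
      time.\<close>
    define V where "V = Max (insert 0 ((\<lambda>h. vec_norm_inf (u h)) ` {..<k}))"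
    have "0 \<le> V" "\<forall>j<k. vec_norm_inf (u j) \<le> V"
      by (auto simp: V_def intro!: Max_ge)
    from bound[OF bg run box this] show ?thesis
      by (simp add: x b V_def[symmetric] distrib_left)
  qed
  then show ?thesis
    unfolding ISS_inf_def
    using class_KL_exponential[OF qK(3,1,2)] class_K_inf_linear[OF qK(3)] by blast
qed

end
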